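(* Let $n\geq 1$ and let $\mathbb{F}$ be a field of characteristic different from two that contains $2n-1$ pairwise distinct scalars. Let $A_n=\mathbb{F}[t]/(t^n)$. Then $\operatorname{edim}(A_n)=2n-1$. In particular, if $n>1$ then $A_n$ is not an evolution algebra.
   Context: An algebra over a field $\mathbb{F}$ is an $\mathbb{F}$-vector space with a bilinear multiplication, not assumed associative or unital. Algebra morphisms are linear multiplicative maps (not required to preserve a unit). An algebra $E$ over $\mathbb{F}$ is an evolution algebra if it admits a basis $\{e_i : i\in I\}$, called a natural basis, such that $e_ie_j=0$ whenever $i\neq j$. For a finite-dimensional commutative algebra $A$, the minimal evolution dimension is $\operatorname{edim}(A)=\min\{\dim E : E \text{ is an evolution } \mathbb{F}\text{-algebra admitting an algebra monomorphism } A\hookrightarrow E\}$. *)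

theory Defs
  imports "Jordan_Normal_Form.VS_Connect" "HOL-Algebra.QuotRing"
begin

text \<open>
  An algebra over a field \<open>K\<close> is a vector space with a bilinear multiplication, neither
  associative nor unital in general.  It is carried by a record of type \<open>module\<close>, whose
  field \<open>one\<close> is not constrained and has no meaning here.
\<close>

locale nonassoc_algebra = vectorspace K A for K and A (structure) +
  assumes mult_closed:
      "\<lbrakk>x \<in> carrier A; y \<in> carrier A\<rbrakk> \<Longrightarrow> x \<otimes> y \<in> carrier A"
    and mult_add_left:
      "\<lbrakk>x \<in> carrier A; y \<in> carrier A; z \<in> carrier A\<rbrakk> \<Longrightarrow> (x \<oplus> y) \<otimes> z = x \<otimes> z \<oplus> y \<otimes> z"
    and mult_add_right:
      "\<lbrakk>x \<in> carrier A; y \<in> carrier A; z \<in> carrier A\<rbrakk> \<Longrightarrow> x \<otimes> (y \<oplus> z) = x \<otimes> y \<oplus> x \<otimes> z"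
    and mult_smult_left:
      "\<lbrakk>c \<in> carrier K; x \<in> carrier A; y \<in> carrier A\<rbrakk> \<Longrightarrow> (c \<odot>\<^bsub>A\<^esub> x) \<otimes> y = c \<odot>\<^bsub>A\<^esub> (x \<otimes> y)"
    and mult_smult_right:
      "\<lbrakk>c \<in> carrier K; x \<in> carrier A; y \<in> carrier A\<rbrakk> \<Longrightarrow> x \<otimes> (c \<odot>\<^bsub>A\<^esub> y) = c \<odot>\<^bsub>A\<^esub> (x \<otimes> y)"

definition natural_basis ::
    "('a, 'm) ring_scheme \<Rightarrow> ('a, 'b, 'n) module_scheme \<Rightarrow> 'b set \<Rightarrow> bool" where
  "natural_basis K E B \<longleftrightarrow> vectorspace.basis K E B \<and>
     (\<forall>b\<in>B. \<forall>c\<in>B. b \<noteq> c \<longrightarrow> b \<otimes>\<^bsub>E\<^esub> c = \<zero>\<^bsub>E\<^esub>)"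

definition evolution_algebra ::
    "('a, 'm) ring_scheme \<Rightarrow> ('a, 'b, 'n) module_scheme \<Rightarrow> bool" where
  "evolution_algebra K E \<longleftrightarrow> nonassoc_algebra K E \<and> (\<exists>B. natural_basis K E B)"

locale algebra_mono =
  A: nonassoc_algebra K A + E: nonassoc_algebra K E + linear_map K A E \<phi>
  for K and A (structure) and E (structure) and \<phi> +
  assumes hom_mult:
      "\<lbrakk>x \<in> carrier A; y \<in> carrier A\<rbrakk> \<Longrightarrow> \<phi> (x \<otimes>\<^bsub>A\<^esub> y) = \<phi> x \<otimes>\<^bsub>E\<^esub> \<phi> y"
    and inj: "inj_on \<phi> (carrier A)"

text \<open>
  The minimum runs over the finite-dimensional evolution algebras whose elements have type
  \<open>'a vec\<close> (with arbitrary carrier sets and operations).  This is no loss of generality: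
  every finite-dimensional evolution algebra, over any type of elements, is isomorphic to one
  of these, see \<open>evolution_algebra_transport\<close> and \<open>edim_le\<close> below.  If the set is nonempty,
  then \<open>Inf\<close> is its minimum; if it is empty, then \<open>Inf\<close> is 0, so a positive value is always
  attained.
\<close>

definition edim :: "('a, 'm) ring_scheme \<Rightarrow> ('a, 'b, 'n) module_scheme \<Rightarrow> nat" where
  "edim K A = Inf {vectorspace.dim K E | E :: ('a, 'a vec) module.
     evolution_algebra K E \<and> vectorspace.fin_dim K E \<and> (\<exists>\<phi>. algebra_mono K A E \<phi>)}"

text \<open>
  The algebra \<open>F[t]/(t^n)\<close>: the quotient ring, with a scalar \<open>c\<close> acting as multiplication
  by the class of the constant polynomial \<open>c\<close>.
\<close>

definition trunc_poly_ring :: "nat \<Rightarrow> 'a::field poly set ring" where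
  "trunc_poly_ring n = class_ring Quot (PIdl\<^bsub>class_ring\<^esub> (monom 1 n))"

definition trunc_poly_algebra :: "nat \<Rightarrow> ('a::field, 'a poly set) module" where
  "trunc_poly_algebra n =
     \<lparr>carrier = carrier (trunc_poly_ring n),
      mult = mult (trunc_poly_ring n),
      one = one (trunc_poly_ring n),
      zero = zero (trunc_poly_ring n),
      add = add (trunc_poly_ring n),
      smult = (\<lambda>c X. (PIdl\<^bsub>class_ring\<^esub> (monom 1 n) +>\<^bsub>class_ring\<^esub> [:c:])
                 \<otimes>\<^bsub>trunc_poly_ring n\<^esub> X)\<rparr>"


lemma trunc_poly_algebra_is_algebra:
  "algebra (class_ring :: 'a::field ring) (trunc_poly_algebra n :: ('a, 'a poly set) module)"
proof -
  let ?F = "class_ring :: 'a ring" and ?R = "class_ring :: 'a poly ring"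
  let ?A = "trunc_poly_algebra n :: ('a, 'a poly set) module"
  let ?Q = "trunc_poly_ring n :: 'a poly set ring"
  define I where "I = PIdl\<^bsub>?R\<^esub> (monom 1 n)"
  have R: "cring ?R" by (rule class_cring.cring_axioms)
  interpret I: ideal I ?R unfolding I_def by (rule cring.cgenideal_ideal[OF R]) simp
  have Q: "?Q = ?R Quot I" by (simp add: trunc_poly_ring_def I_def)
  interpret Q: cring ?Q unfolding Q by (rule I.quotient_is_cring[OF R])
  interpret h: ring_hom_ring ?R ?Q "(+>\<^bsub>?R\<^esub>) I" unfolding Q by (rule I.rcos_ring_hom_ring)
  have sel: "carrier ?A = carrier ?Q" "mult ?A = mult ?Q" "one ?A = one ?Q"
      "zero ?A = zero ?Q" "add ?A = add ?Q"
      "\<And>c X. c \<odot>\<^bsub>?A\<^esub> X = (I +>\<^bsub>?R\<^esub> [:c:]) \<otimes>\<^bsub>?Q\<^esub> X"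
    by (simp_all add: trunc_poly_algebra_def I_def)
  have h_closed: "I +>\<^bsub>?R\<^esub> p \<in> carrier ?Q" for p using h.hom_closed[of p] by simp
  have h_add: "I +>\<^bsub>?R\<^esub> [:a + b:] = (I +>\<^bsub>?R\<^esub> [:a:]) \<oplus>\<^bsub>?Q\<^esub> (I +>\<^bsub>?R\<^esub> [:b:])" for a b
    using h.hom_add[of "[:a:]" "[:b:]"] by simp
  have h_mult: "I +>\<^bsub>?R\<^esub> [:a * b:] = (I +>\<^bsub>?R\<^esub> [:a:]) \<otimes>\<^bsub>?Q\<^esub> (I +>\<^bsub>?R\<^esub> [:b:])" for a b
    using h.hom_mult[of "[:a:]" "[:b:]"] by (simp add: mult.commute)
  have h_one: "I +>\<^bsub>?R\<^esub> [:1:] = \<one>\<^bsub>?Q\<^esub>"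
    using h.hom_one by (simp add: one_pCons)
  have ag: "abelian_group ?A"
  proof (rule abelian_groupI)
    fix X assume "X \<in> carrier ?A"
    then show "\<exists>Y\<in>carrier ?A. Y \<oplus>\<^bsub>?A\<^esub> X = \<zero>\<^bsub>?A\<^esub>"
      by (intro bexI[of _ "\<ominus>\<^bsub>?Q\<^esub> X"]) (simp_all add: sel Q.l_neg)
  qed (simp_all add: sel Q.a_ac)
  have cm: "comm_monoid ?A"
    by (rule comm_monoidI) (simp_all add: sel Q.m_ac)
  have cr: "cring ?A"
    by (rule cringI[OF ag cm]) (simp add: sel Q.l_distr)
  show ?thesis
    by (rule algebraI[OF class_cring.cring_axioms cr])
      (simp_all add: sel h_closed h_add h_mult h_one Q.m_assoc Q.l_distr Q.r_distr)
qed

lemma trunc_poly_algebra_is_nonassoc_algebra: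
  "nonassoc_algebra (class_ring :: 'a::field ring)
     (trunc_poly_algebra n :: ('a, 'a poly set) module)"
proof -
  let ?F = "class_ring :: 'a ring"
  let ?A = "trunc_poly_algebra n :: ('a, 'a poly set) module"
  interpret A: algebra ?F ?A by (rule trunc_poly_algebra_is_algebra)
  interpret F: field ?F by (rule class_field)
  have vs: "vectorspace ?F ?A" by unfold_locales
  have comm: "x \<otimes>\<^bsub>?A\<^esub> (c \<odot>\<^bsub>?A\<^esub> y) = c \<odot>\<^bsub>?A\<^esub> (x \<otimes>\<^bsub>?A\<^esub> y)"
    if "c \<in> carrier ?F" "x \<in> carrier ?A" "y \<in> carrier ?A" for c x y
    using that by (metis A.smult_assoc2 A.m_comm A.smult_closed)
  show ?thesis
    by (intro nonassoc_algebra.intro nonassoc_algebra_axioms.intro)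
      (rule vs comm A.smult_assoc2 A.l_distr A.r_distr A.m_closed; assumption)+
qed

lemma evolution_algebra_transport:
  fixes K :: "('a, 'm) ring_scheme" and E :: "('a, 'e, 'n) module_scheme"
  assumes evo: "evolution_algebra K E" and fd: "vectorspace.fin_dim K E"
  obtains E' :: "('a, 'a vec) module" and \<psi>
  where "evolution_algebra K E'" and "vectorspace.fin_dim K E'"
    and "vectorspace.dim K E' = vectorspace.dim K E"
    and "algebra_mono K E E' \<psi>" and "\<psi> ` carrier E = carrier E'"
proof -
  obtain B where B: "natural_basis K E B" and alg: "nonassoc_algebra K E"
    using evo by (auto simp: evolution_algebra_def)
  interpret E: nonassoc_algebra K E by (rule alg)
  have bas: "E.basis B" using B by (simp add: natural_basis_def)
  then have Bc: "B \<subseteq> carrier E" and Bli: "E.lin_indpt B" and Bg: "E.span B = carrier E"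
    by (auto simp: E.basis_def)
  have fB: "finite B" by (rule E.fin_dim_li_fin[OF fd Bli Bc])
  obtain bs where bs: "set bs = B" using finite_list[OF fB] by blast
  have "\<forall>v\<in>carrier E. \<exists>a. a \<in> B \<rightarrow> carrier K \<and> E.lincomb a B = v"
    using E.finite_in_span[OF fB Bc] Bg by blast
  then obtain co where co: "\<And>v. v \<in> carrier E \<Longrightarrow> co v \<in> B \<rightarrow> carrier K \<and> E.lincomb (co v) B = v"
    by metis
  define f where "f v = vec (length bs) (\<lambda>i. co v (bs ! i))" for v
  have inj: "inj_on f (carrier E)"
  proof (rule inj_onI)
    fix v w assume v: "v \<in> carrier E" and w: "w \<in> carrier E" and eq: "f v = f w"
    have "co v b = co w b" if b: "b \<in> B" for b
    proof -
      obtain i where i: "i < length bs" "b = bs ! i" using b bs by (metis in_set_conv_nth)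
      have "f v $ i = f w $ i" using eq by simp
      then show ?thesis using i by (simp add: f_def)
    qed
    then have "E.lincomb (co v) B = E.lincomb (co w) B"
      using co[OF w] Bc by (intro E.lincomb_cong) auto
    then show "v = w" using co[OF v] co[OF w] by simp
  qed
  define g where "g = inv_into (carrier E) f"
  have gf: "g (f v) = v" if "v \<in> carrier E" for v
    using that inj by (simp add: g_def)
  define E' :: "('a, 'a vec) module" where "E' =
    \<lparr>carrier = f ` carrier E, mult = (\<lambda>x y. f (g x \<otimes>\<^bsub>E\<^esub> g y)), one = f \<one>\<^bsub>E\<^esub>,
     zero = f \<zero>\<^bsub>E\<^esub>, add = (\<lambda>x y. f (g x \<oplus>\<^bsub>E\<^esub> g y)), smult = (\<lambda>c x. f (c \<odot>\<^bsub>E\<^esub> g x))\<rparr>"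
  have sel: "carrier E' = f ` carrier E" "\<zero>\<^bsub>E'\<^esub> = f \<zero>\<^bsub>E\<^esub>"
    by (simp_all add: E'_def)
  have f_add: "f x \<oplus>\<^bsub>E'\<^esub> f y = f (x \<oplus>\<^bsub>E\<^esub> y)"
    and f_mult: "f x \<otimes>\<^bsub>E'\<^esub> f y = f (x \<otimes>\<^bsub>E\<^esub> y)" if "x \<in> carrier E" "y \<in> carrier E" for x y
    using that by (simp_all add: E'_def gf)
  have f_smult: "c \<odot>\<^bsub>E'\<^esub> f x = f (c \<odot>\<^bsub>E\<^esub> x)" if "x \<in> carrier E" for c x
    using that by (simp add: E'_def gf)
  have fld: "field K" ..
  have vs: "vectorspace K E'"
  proof (rule vs_criteria[OF fld])
    show "\<forall>v\<in>carrier E'. \<exists>w\<in>carrier E'. v \<oplus>\<^bsub>E'\<^esub> w = \<zero>\<^bsub>E'\<^esub>"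
    proof
      fix v assume "v \<in> carrier E'"
      then obtain x where x: "x \<in> carrier E" "v = f x" by (auto simp: sel)
      then show "\<exists>w\<in>carrier E'. v \<oplus>\<^bsub>E'\<^esub> w = \<zero>\<^bsub>E'\<^esub>"
        by (intro bexI[of _ "f (\<ominus>\<^bsub>E\<^esub> x)"]) (auto simp: sel f_add E.M.r_neg)
    qed
  qed (auto simp: sel f_add f_smult E.M.a_ac E.smult_l_distr E.smult_r_distr
      E.smult_assoc1)
  have alg': "nonassoc_algebra K E'"
    by (intro nonassoc_algebra.intro nonassoc_algebra_axioms.intro vs)
      (auto simp: sel f_add f_smult f_mult E.mult_closed E.mult_add_left E.mult_add_right
        E.mult_smult_left E.mult_smult_right)
  interpret E': nonassoc_algebra K E' by (rule alg')
  interpret f: linear_map K E E' f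
  proof unfold_locales
    show "f \<in> LinearCombinations.module_hom K E E'"
      by (simp add: LinearCombinations.module_hom_def sel f_add f_smult)
  qed
  have mono: "algebra_mono K E E' f"
    by (intro algebra_mono.intro algebra_mono_axioms.intro alg alg' f.linear_map_axioms inj)
      (simp add: f_mult)
  have injB: "inj_on f B" using inj Bc by (rule inj_on_subset)
  have lc: "E'.lincomb a (f ` B) = f (E.lincomb (a \<circ> f) B)"
    if a: "a \<in> f ` B \<rightarrow> carrier K" for a
  proof -
    have af: "a \<circ> f \<in> B \<rightarrow> carrier K" using a by auto
    have cl: "a (f b) \<odot>\<^bsub>E\<^esub> b \<in> carrier E" if "b \<in> B" for b
      using that a Bc by (intro E.smult_closed) auto
    have sm: "a (f b) \<odot>\<^bsub>E'\<^esub> f b = f (a (f b) \<odot>\<^bsub>E\<^esub> b)" if "b \<in> B" for b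
      using that Bc by (intro f_smult) auto
    have "E'.lincomb a (f ` B) = (\<Oplus>\<^bsub>E'\<^esub>b\<in>B. a (f b) \<odot>\<^bsub>E'\<^esub> f b)"
      unfolding E'.lincomb_def
    proof (rule E'.M.finsum_reindex[OF _ injB])
      show "(\<lambda>v. a v \<odot>\<^bsub>E'\<^esub> v) \<in> f ` B \<rightarrow> carrier E'"
        using cl by (auto simp: sm sel)
    qed
    also have "\<dots> = (\<Oplus>\<^bsub>E'\<^esub>b\<in>B. f (a (f b) \<odot>\<^bsub>E\<^esub> b))"
      using cl by (intro E'.M.finsum_cong') (simp_all add: sm sel)
    also have "\<dots> = f (\<Oplus>\<^bsub>E\<^esub>b\<in>B. a (f b) \<odot>\<^bsub>E\<^esub> b)"
      using cl Bc by (intro f.hom_sum[symmetric]) auto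
    finally show ?thesis by (simp add: E.lincomb_def)
  qed
  have fB': "finite (f ` B)" using fB by simp
  have Bc': "f ` B \<subseteq> carrier E'" using Bc by (auto simp: sel)
  have li': "E'.lin_indpt (f ` B)"
  proof (rule E'.finite_lin_indpt2[OF fB' Bc'])
    fix a assume a: "a \<in> f ` B \<rightarrow> carrier K" and z: "E'.lincomb a (f ` B) = \<zero>\<^bsub>E'\<^esub>"
    have af: "a \<circ> f \<in> B \<rightarrow> carrier K" using a by auto
    have "f (E.lincomb (a \<circ> f) B) = f \<zero>\<^bsub>E\<^esub>" using z by (simp only: lc[OF a] sel(2))
    then have "E.lincomb (a \<circ> f) B = \<zero>\<^bsub>E\<^esub>"
      using E.lincomb_closed[OF Bc af] E.M.zero_closed by (rule inj_onD[OF inj])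
    then have "(a \<circ> f) b = \<zero>\<^bsub>K\<^esub>" if "b \<in> B" for b
      using E.lin_dep_crit[OF fB subset_refl af that] Bli by blast
    then show "\<forall>v\<in>f ` B. a v = \<zero>\<^bsub>K\<^esub>" by auto
  qed
  have gen': "E'.span (f ` B) = carrier E'"
  proof
    show "E'.span (f ` B) \<subseteq> carrier E'" by (rule E'.span_is_subset2[OF Bc'])
    show "carrier E' \<subseteq> E'.span (f ` B)"
    proof
      fix w assume "w \<in> carrier E'"
      then obtain v where v: "v \<in> carrier E" "w = f v" by (auto simp: sel)
      define a where "a = co v \<circ> g"
      have ab: "a (f b) = co v b" if "b \<in> B" for b
        using that Bc by (auto simp: a_def gf subset_iff)
      have a: "a \<in> f ` B \<rightarrow> carrier K" using co[OF v(1)] ab by auto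
      have "E.lincomb (a \<circ> f) B = E.lincomb (co v) B"
        using co[OF v(1)] Bc ab by (intro E.lincomb_cong) auto
      then have "E'.lincomb a (f ` B) = w" using lc[OF a] co[OF v(1)] v by simp
      then show "w \<in> E'.span (f ` B)"
        using a by (auto simp: E'.finite_span[OF fB' Bc'])
    qed
  qed
  have bas': "E'.basis (f ` B)" using li' gen' Bc' by (simp add: E'.basis_def)
  have "natural_basis K E' (f ` B)"
    unfolding natural_basis_def
  proof (intro conjI bas' ballI impI)
    fix x y assume "x \<in> f ` B" "y \<in> f ` B" "x \<noteq> y"
    then obtain b c where bc: "x = f b" "y = f c" "b \<in> B" "c \<in> B" "b \<noteq> c" by auto
    then have "b \<otimes>\<^bsub>E\<^esub> c = \<zero>\<^bsub>E\<^esub>" using B by (auto simp: natural_basis_def)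
    moreover have "x \<otimes>\<^bsub>E'\<^esub> y = f (b \<otimes>\<^bsub>E\<^esub> c)" using bc Bc f_mult by blast
    ultimately show "x \<otimes>\<^bsub>E'\<^esub> y = \<zero>\<^bsub>E'\<^esub>" by (simp only: sel(2))
  qed
  then have evo': "evolution_algebra K E'" using alg' by (auto simp: evolution_algebra_def)
  have fd': "E'.fin_dim" using fB' Bc' gen' by (auto simp: E'.fin_dim_def)
  have "E'.dim = card (f ` B)" by (rule E'.dim_basis[OF fB' bas'])
  also have "\<dots> = E.dim" using card_image[OF injB] E.dim_basis[OF fB bas] by simp
  finally show thesis using that evo' fd' mono sel(1) by metis
qed

lemma edim_le:
  fixes K :: "('a, 'm) ring_scheme" and A :: "('a, 'b, 'k) module_scheme"
    and E :: "('a, 'e, 'n) module_scheme"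
  assumes "evolution_algebra K E" and "vectorspace.fin_dim K E" and mono: "algebra_mono K A E \<phi>"
  shows "edim K A \<le> vectorspace.dim K E"
proof -
  obtain E' :: "('a, 'a vec) module" and \<psi> where
    E': "evolution_algebra K E'" "vectorspace.fin_dim K E'"
      "vectorspace.dim K E' = vectorspace.dim K E" and iso: "algebra_mono K E E' \<psi>"
    using evolution_algebra_transport[OF assms(1,2)] by metis
  interpret \<phi>: algebra_mono K A E \<phi> by (rule mono)
  interpret \<psi>: algebra_mono K E E' \<psi> by (rule iso)
  have in_E: "\<phi> x \<in> carrier E" if "x \<in> carrier A" for x
    using that by (rule \<phi>.f_im)
  have "linear_map K A E' (\<psi> \<circ> \<phi>)"
  proof unfold_locales
    show "\<psi> \<circ> \<phi> \<in> LinearCombinations.module_hom K A E'"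
      by (simp add: LinearCombinations.module_hom_def in_E)
  qed
  moreover have "inj_on (\<psi> \<circ> \<phi>) (carrier A)"
    using \<phi>.inj \<psi>.inj in_E by (auto intro!: comp_inj_on elim: inj_on_subset)
  ultimately have "algebra_mono K A E' (\<psi> \<circ> \<phi>)"
    by (intro algebra_mono.intro algebra_mono_axioms.intro
        \<phi>.A.nonassoc_algebra_axioms \<psi>.E.nonassoc_algebra_axioms)
      (auto simp: \<phi>.hom_mult \<psi>.hom_mult in_E)
  then have "vectorspace.dim K E' \<in> {vectorspace.dim K E | E :: ('a, 'a vec) module.
     evolution_algebra K E \<and> vectorspace.fin_dim K E \<and> (\<exists>\<phi>. algebra_mono K A E \<phi>)}"
    using E'(1,2) by blast
  then show ?thesis
    unfolding edim_def E'(3)[symmetric] by (intro cInf_lower) auto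
qed

end

theory Submission
  imports Defs
begin

text \<open>
  Lower bound.  Expand the image of \<open>F[t]/(t^n)\<close> in a natural basis \<open>B\<close>.  The coordinates indexed
  by \<open>B\<close> separate the points of \<open>F[t]/(t^n)\<close>, so \<open>n - 1\<close> of them can be made to vanish on a
  suitable element \<open>x\<close> of \<open>1 + (t)\<close>.  Since \<open>x\<close> is a unit and products in \<open>E\<close> are formed
  coordinatewise, an element on which all the other coordinates vanish is annihilated by \<open>x\<close>,
  hence is zero; so there are at least \<open>n\<close> others.

  Upper bound.  Let \<open>g\<close> be the product of \<open>t - a\<close> over \<open>2n - 1\<close> distinct scalars \<open>a\<close>.  On the
  polynomials of degree less than \<open>2n - 1\<close>, multiply modulo \<open>g\<close> and then reduce modulo \<open>t^n\<close>.
  The polynomials \<open>g / (t - a)\<close> form a natural basis, and the residues of degree less than \<open>n\<close>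
  multiply as in \<open>F[t]/(t^n)\<close>, because the reduction modulo \<open>g\<close> does not affect their products.
\<close>

section \<open>Linear systems with injective coefficient matrix\<close>

text \<open>An injective matrix with \<open>d\<close> columns has \<open>d\<close> rows that form an
  invertible square matrix, so on these rows every right-hand side is attained. The induction on
  \<open>d\<close> is Gaussian elimination of the last unknown; \<open>B\<close> may be
  infinite.\<close>

lemma solvable_subsystem_of_injective:
  fixes M :: "'b \<Rightarrow> nat \<Rightarrow> 'a::field" and r :: "'b \<Rightarrow> 'a"
  assumes "\<And>c. \<forall>b\<in>B. (\<Sum>j<d. c j * M b j) = 0 \<Longrightarrow> \<forall>j<d. c j = 0"
  shows "\<exists>B'\<subseteq>B. finite B' \<and> card B' = d \<and> (\<exists>c. \<forall>b\<in>B'. (\<Sum>j<d. c j * M b j) = r b)"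
  using assms
proof (induction d arbitrary: B M r)
  case 0
  show ?case by (intro exI[of _ "{}"]) simp
next
  case (Suc d)
  \<comment> \<open>Injectivity on the last unit vector says that column \<open>d\<close> is not
    zero.\<close>
  obtain b where b: "b \<in> B" and pivot: "M b d \<noteq> 0"
  proof -
    let ?c = "\<lambda>j. if j = d then 1 else 0 :: 'a"
    have "(\<Sum>j<Suc d. ?c j * M b j) = M b d" for b by simp
    then show thesis using Suc.prems[of ?c] that by fastforce
  qed
  \<comment> \<open>Row \<open>b\<close> with right-hand side \<open>s\<close> determines the last
    unknown; substituting it into row \<open>b'\<close> gives row \<open>b'\<close> of
    \<open>N\<close> plus the constant \<open>M b' d * s / M b d\<close>. The case
    \<open>s = 0\<close> makes \<open>N\<close> injective, and the case \<open>s = r b\<close>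
    yields the solution.\<close>
  define N where "N b' j = M b' j - M b' d * M b j / M b d" for b' j
  have elim: "(\<Sum>j<d. c j * M b' j) + (s - (\<Sum>j<d. c j * M b j)) / M b d * M b' d
      = (\<Sum>j<d. c j * N b' j) + M b' d * s / M b d" for c s b'
  proof -
    have "(\<Sum>j<d. c j * N b' j)
        = (\<Sum>j<d. c j * M b' j) - (\<Sum>j<d. c j * M b j * (M b' d / M b d))"
      unfolding sum_subtractf[symmetric] by (rule sum.cong) (simp_all add: N_def field_simps)
    also have "\<dots> = (\<Sum>j<d. c j * M b' j) - (\<Sum>j<d. c j * M b j) * (M b' d / M b d)"
      by (simp only: sum_distrib_right)
    finally show ?thesis using pivot by (simp add: field_simps)
  qed
  have ext: "(\<Sum>j<Suc d. (c(d := (s - (\<Sum>j<d. c j * M b j)) / M b d)) j * M b' j)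
      = (\<Sum>j<d. c j * N b' j) + M b' d * s / M b d" for c s b'
    using elim[of c b' s] by simp
  have zero: "N b j = 0" for j
    using pivot by (simp add: N_def)
  have "\<forall>j<d. c j = 0" if c: "\<forall>b'\<in>B - {b}. (\<Sum>j<d. c j * N b' j) = 0" for c
  proof -
    have "\<forall>b'\<in>B. (\<Sum>j<d. c j * N b' j) = 0" using c zero by auto
    then have "\<forall>j<Suc d. (c(d := (0 - (\<Sum>j<d. c j * M b j)) / M b d)) j = 0"
      by (intro Suc.prems) (simp only: ext, simp)
    then show ?thesis by (metis fun_upd_other less_SucI less_irrefl)
  qed
  from Suc.IH[of "B - {b}" N, OF this, of "\<lambda>b'. r b' - M b' d * r b / M b d"]
  obtain B' c where B': "B' \<subseteq> B - {b}" "finite B'" "card B' = d"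
    and c: "\<forall>b'\<in>B'. (\<Sum>j<d. c j * N b' j) = r b' - M b' d * r b / M b d"
    by blast
  show ?case
  proof (intro exI[of _ "insert b B'"] conjI
      exI[of _ "c(d := (r b - (\<Sum>j<d. c j * M b j)) / M b d)"] ballI)
    fix b' assume "b' \<in> insert b B'"
    then show "(\<Sum>j<Suc d. (c(d := (r b - (\<Sum>j<d. c j * M b j)) / M b d)) j * M b' j) = r b'"
      unfolding ext using c zero pivot by auto
  qed (use B' b in \<open>auto simp: card_insert_if\<close>)
qed

section \<open>Residue classes of polynomials modulo a power of t\<close>

text \<open>A polynomial with nonzero constant term has order 0 at 0, so all of the order of the
  product comes from \<open>q\<close>. In other words, \<open>p\<close> is a unit modulo
  t^n.\<close>

lemma monom_dvd_mult_cancel: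
  fixes p q :: "'a::field poly"
  assumes "coeff p 0 \<noteq> 0" and "monom 1 n dvd p * q"
  shows "monom 1 n dvd q"
proof (cases "q = 0")
  case False
  have "p \<noteq> 0" using assms(1) by auto
  moreover have "order 0 p = 0"
    using assms(1) by (intro order_0I) (simp add: poly_0_coeff_0)
  ultimately show ?thesis
    using assms(2) False by (simp add: monom_1_dvd_iff order_mult)
qed simp

definition trunc_class :: "nat \<Rightarrow> 'a::field poly \<Rightarrow> 'a poly set" where
  "trunc_class n p = PIdl\<^bsub>class_ring\<^esub> (monom 1 n) +>\<^bsub>class_ring\<^esub> p"

text \<open>These rules replace computations with cosets by computations with polynomials: the class
  map is a surjective homomorphism, and two classes agree iff t^n divides the difference of the
  representatives.\<close>

lemma
  fixes n :: nat
  defines "A \<equiv> trunc_poly_algebra n :: ('a::field, 'a poly set) module"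
  shows carrier_trunc_poly_algebra: "carrier A = range (trunc_class n)"
    and trunc_class_add: "trunc_class n p \<oplus>\<^bsub>A\<^esub> trunc_class n q = trunc_class n (p + q)"
    and trunc_class_mult: "trunc_class n p \<otimes>\<^bsub>A\<^esub> trunc_class n q = trunc_class n (p * q)"
    and trunc_class_smult: "c \<odot>\<^bsub>A\<^esub> trunc_class n p = trunc_class n (Polynomial.smult c p)"
    and trunc_class_zero: "trunc_class n 0 = \<zero>\<^bsub>A\<^esub>"
    and trunc_class_eq_iff: "trunc_class n p = trunc_class n q \<longleftrightarrow> monom 1 n dvd p - q"
proof -
  let ?R = "class_ring :: 'a poly ring" and ?Q = "trunc_poly_ring n :: 'a poly set ring"
  define I where "I = PIdl\<^bsub>?R\<^esub> (monom 1 n)"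
  have R: "cring ?R" by (rule class_cring.cring_axioms)
  interpret I: ideal I ?R unfolding I_def by (rule cring.cgenideal_ideal[OF R]) simp
  have Q: "?Q = ?R Quot I" by (simp add: trunc_poly_ring_def I_def)
  interpret h: ring_hom_ring ?R ?Q "(+>\<^bsub>?R\<^esub>) I" unfolding Q by (rule I.rcos_ring_hom_ring)
  have cls: "trunc_class n p = I +>\<^bsub>?R\<^esub> p" for p by (simp add: trunc_class_def I_def)
  have sel: "carrier A = carrier ?Q" "mult A = mult ?Q" "zero A = zero ?Q" "add A = add ?Q"
      "\<And>c X. c \<odot>\<^bsub>A\<^esub> X = (I +>\<^bsub>?R\<^esub> [:c:]) \<otimes>\<^bsub>?Q\<^esub> X"
    by (simp_all add: A_def trunc_poly_algebra_def I_def)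
  show "carrier A = range (trunc_class n)"
    by (auto simp: sel cls Q FactRing_def A_RCOSETS_def')
  show "trunc_class n p \<oplus>\<^bsub>A\<^esub> trunc_class n q = trunc_class n (p + q)"
    using h.hom_add[of p q] by (simp add: sel cls)
  show "trunc_class n p \<otimes>\<^bsub>A\<^esub> trunc_class n q = trunc_class n (p * q)"
    using h.hom_mult[of p q] by (simp add: sel cls)
  show "c \<odot>\<^bsub>A\<^esub> trunc_class n p = trunc_class n (Polynomial.smult c p)"
    using h.hom_mult[of "[:c:]" p] by (simp add: sel cls)
  show "trunc_class n 0 = \<zero>\<^bsub>A\<^esub>"
    using h.hom_zero by (simp add: sel cls)
  have mem: "x \<in> I \<longleftrightarrow> monom 1 n dvd x" for x
    by (auto simp: I_def cgenideal_def dvd_def mult.commute)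
  have "trunc_class n p = trunc_class n q \<longleftrightarrow> p - q \<in> I"
    using ring.quotient_eq_iff_same_a_r_cos[OF cring.axioms(1)[OF R] I.ideal_axioms, of p q]
    by (simp add: cls class_ring_simps)
  then show "trunc_class n p = trunc_class n q \<longleftrightarrow> monom 1 n dvd p - q"
    by (simp add: mem)
qed

section \<open>Monomorphisms, and the dimension of F[t]/(t^n)\<close>

lemma algebra_mono_compose:
  assumes \<phi>: "algebra_mono K A E \<phi>" and \<psi>: "algebra_mono K E E' \<psi>"
  shows "algebra_mono K A E' (\<psi> \<circ> \<phi>)"
proof -
  interpret \<phi>: algebra_mono K A E \<phi> by (rule \<phi>)
  interpret \<psi>: algebra_mono K E E' \<psi> by (rule \<psi>)
  have in_E: "\<phi> x \<in> carrier E" if "x \<in> carrier A" for x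
    using that by (rule \<phi>.f_im)
  have "linear_map K A E' (\<psi> \<circ> \<phi>)"
  proof unfold_locales
    show "\<psi> \<circ> \<phi> \<in> LinearCombinations.module_hom K A E'"
      by (simp add: LinearCombinations.module_hom_def in_E)
  qed
  moreover have "inj_on (\<psi> \<circ> \<phi>) (carrier A)"
    using \<phi>.inj \<psi>.inj in_E by (auto intro!: comp_inj_on elim: inj_on_subset)
  ultimately show ?thesis
    by (intro algebra_mono.intro algebra_mono_axioms.intro
        \<phi>.A.nonassoc_algebra_axioms \<psi>.E.nonassoc_algebra_axioms)
      (auto simp: \<phi>.hom_mult \<psi>.hom_mult in_E)
qed

lemma algebra_mono_id:
  assumes "nonassoc_algebra K A"
  shows "algebra_mono K A A (\<lambda>x. x)"
proof -
  interpret A: nonassoc_algebra K A by (rule assms)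
  have "linear_map K A A (\<lambda>x. x)"
    by unfold_locales (simp add: LinearCombinations.module_hom_def)
  then show ?thesis
    by (intro algebra_mono.intro algebra_mono_axioms.intro assms) simp_all
qed

text \<open>The classes of 1, t, ..., t^(n-1) span, since the terms of degree at least
  \<open>n\<close> of a polynomial do not affect its class.\<close>

lemma trunc_poly_algebra_dim_le:
  fixes n :: nat
  defines "A \<equiv> trunc_poly_algebra n :: ('a::field, 'a poly set) module"
  shows "vectorspace.fin_dim (class_ring :: 'a ring) A"
    and "vectorspace.dim (class_ring :: 'a ring) A \<le> n"
proof -
  let ?F = "class_ring :: 'a ring"
  interpret A: nonassoc_algebra ?F A
    unfolding A_def by (rule trunc_poly_algebra_is_nonassoc_algebra)
  define G :: "'a poly set set" where "G = (\<lambda>j. trunc_class n (monom 1 j)) ` {..<n}"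
  have fin: "finite G" by (simp add: G_def)
  have G: "G \<subseteq> carrier A" by (auto simp: G_def A_def carrier_trunc_poly_algebra)
  interpret G: submodule ?F "A.span G" A by (rule A.span_is_submodule[OF G])
  have "trunc_class n (\<Sum>j<m. monom (c j) j) \<in> A.span G" if "m \<le> n" for m and c :: "nat \<Rightarrow> 'a"
    using that
  proof (induction m)
    case 0
    show ?case using A.span_zero by (simp add: trunc_class_zero A_def)
  next
    case (Suc m)
    have "trunc_class n (monom 1 m) \<in> A.span G"
      using Suc.prems A.in_own_span[OF G] by (auto simp: G_def)
    then have "c m \<odot>\<^bsub>A\<^esub> trunc_class n (monom 1 m) \<in> A.span G"
      by (intro G.smult_closed) auto
    then have "trunc_class n (monom (c m) m) \<in> A.span G"
      by (simp add: A_def trunc_class_smult smult_monom)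
    with Suc have "trunc_class n (\<Sum>j<m. monom (c j) j) \<oplus>\<^bsub>A\<^esub> trunc_class n (monom (c m) m)
        \<in> A.span G"
      by (intro G.m_closed) auto
    then show ?case by (simp add: A_def trunc_class_add)
  qed
  from this[of n] have "trunc_class n (\<Sum>j<n. monom (coeff p j) j) \<in> A.span G" for p by simp
  moreover have "trunc_class n p = trunc_class n (\<Sum>j<n. monom (coeff p j) j)" for p :: "'a poly"
    by (auto simp: trunc_class_eq_iff monom_1_dvd_iff' coeff_sum)
  ultimately have "carrier A \<subseteq> A.span G"
    by (auto simp: A_def carrier_trunc_poly_algebra)
  then have gen: "A.span G = carrier A" using A.span_is_subset2[OF G] by auto
  then show "A.fin_dim" using fin G by (auto simp: A.fin_dim_def)
  have "A.dim \<le> card G" by (rule A.gen_ge_dim[OF fin G gen])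
  also have "\<dots> \<le> n" using card_image_le[of "{..<n}"] by (simp add: G_def)
  finally show "A.dim \<le> n" .
qed

section \<open>Lower bound: counting orthogonal generators\<close>

context nonassoc_algebra
begin

lemma mult_zero_left: "y \<in> carrier A \<Longrightarrow> \<zero>\<^bsub>A\<^esub> \<otimes>\<^bsub>A\<^esub> y = \<zero>\<^bsub>A\<^esub>"
  using mult_smult_left[of "\<zero>\<^bsub>K\<^esub>" "\<zero>\<^bsub>A\<^esub>" y] by (simp add: mult_closed)

lemma mult_zero_right: "y \<in> carrier A \<Longrightarrow> y \<otimes>\<^bsub>A\<^esub> \<zero>\<^bsub>A\<^esub> = \<zero>\<^bsub>A\<^esub>"
  using mult_smult_right[of "\<zero>\<^bsub>K\<^esub>" y "\<zero>\<^bsub>A\<^esub>"] by (simp add: mult_closed)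

lemma finsum_mult_eq_zero:
  assumes "finite S" "f \<in> S \<rightarrow> carrier A" "y \<in> carrier A" "\<And>s. s \<in> S \<Longrightarrow> f s \<otimes>\<^bsub>A\<^esub> y = \<zero>\<^bsub>A\<^esub>"
  shows "finsum A f S \<otimes>\<^bsub>A\<^esub> y = \<zero>\<^bsub>A\<^esub>"
  using assms by (induction S) (auto simp: mult_zero_left mult_add_left Pi_iff)

lemma mult_finsum_eq_zero:
  assumes "finite S" "f \<in> S \<rightarrow> carrier A" "y \<in> carrier A" "\<And>s. s \<in> S \<Longrightarrow> y \<otimes>\<^bsub>A\<^esub> f s = \<zero>\<^bsub>A\<^esub>"
  shows "y \<otimes>\<^bsub>A\<^esub> finsum A f S = \<zero>\<^bsub>A\<^esub>"
  using assms by (induction S) (auto simp: mult_zero_right mult_add_right Pi_iff)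

text \<open>In the double sum given by bilinearity, the terms off the diagonal vanish by
  orthogonality, and each diagonal term has a factor with coefficient zero.\<close>

lemma lincomb_mult_eq_zero:
  assumes fin: "finite B" and B: "B \<subseteq> carrier A"
    and orth: "\<And>b c. b \<in> B \<Longrightarrow> c \<in> B \<Longrightarrow> b \<noteq> c \<Longrightarrow> b \<otimes>\<^bsub>A\<^esub> c = \<zero>\<^bsub>A\<^esub>"
    and u: "u \<in> B \<rightarrow> carrier K" and v: "v \<in> B \<rightarrow> carrier K"
    and disj: "\<And>b. b \<in> B \<Longrightarrow> u b = \<zero>\<^bsub>K\<^esub> \<or> v b = \<zero>\<^bsub>K\<^esub>"
  shows "lincomb u B \<otimes>\<^bsub>A\<^esub> lincomb v B = \<zero>\<^bsub>A\<^esub>"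
proof -
  have cl: "b \<in> carrier A" "u b \<in> carrier K" "v b \<in> carrier K" if "b \<in> B" for b
    using that B u v by auto
  have summand: "(u b \<odot>\<^bsub>A\<^esub> b) \<otimes>\<^bsub>A\<^esub> (v c \<odot>\<^bsub>A\<^esub> c) = \<zero>\<^bsub>A\<^esub>" if "b \<in> B" "c \<in> B" for b c
  proof (cases "b = c")
    case True
    then show ?thesis using disj[OF that(1)] cl[OF that(1)]
      by (auto simp: mult_zero_left mult_zero_right)
  next
    case False
    then show ?thesis using orth[OF that] cl that
      by (simp add: mult_smult_left mult_smult_right mult_closed)
  qed
  show ?thesis
    unfolding lincomb_def
    by (intro finsum_mult_eq_zero mult_finsum_eq_zero fin summand) (auto simp: cl fin)
qed

end

text \<open>\<open>B\<close> contains disjoint sets of sizes \<open>n - 1\<close> and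
  \<open>n\<close>: on the first the coordinates of some unit vanish, and on the second a square
  coordinate system is solvable.\<close>

lemma card_orthogonal_generators_ge:
  fixes E :: "('a::field, 'e) module" and n :: nat
  assumes n: "n \<ge> 1"
    and mono: "algebra_mono (class_ring :: 'a ring)
      (trunc_poly_algebra n :: ('a, 'a poly set) module) E \<phi>"
    and fin: "finite B" and B: "B \<subseteq> carrier E"
    and gen: "LinearCombinations.module.span (class_ring :: 'a ring) E B = carrier E"
    and orth: "\<And>b c. b \<in> B \<Longrightarrow> c \<in> B \<Longrightarrow> b \<noteq> c \<Longrightarrow> b \<otimes>\<^bsub>E\<^esub> c = \<zero>\<^bsub>E\<^esub>"
  shows "2 * n - 1 \<le> card B"
proof -
  let ?F = "class_ring :: 'a ring"
  let ?A = "trunc_poly_algebra n :: ('a, 'a poly set) module"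
  interpret \<phi>: algebra_mono ?F ?A E \<phi> by (rule mono)
  have cls: "trunc_class n p \<in> carrier ?A" for p :: "'a poly"
    by (simp add: carrier_trunc_poly_algebra)
  \<comment> \<open>The map is lifted to polynomials; it stays multiplicative, and by injectivity of
    \<open>\<phi>\<close> its kernel lies in the multiples of t^n.\<close>
  define \<psi> where "\<psi> p = \<phi> (trunc_class n p)" for p
  have closed: "\<psi> p \<in> carrier E" for p
    unfolding \<psi>_def by (intro \<phi>.f_im cls)
  have add: "\<psi> (p + q) = \<psi> p \<oplus>\<^bsub>E\<^esub> \<psi> q" for p q
    unfolding \<psi>_def by (simp add: trunc_class_add[symmetric] cls)
  have scale: "\<psi> (Polynomial.smult c p) = c \<odot>\<^bsub>E\<^esub> \<psi> p" for c p
    unfolding \<psi>_def by (simp add: trunc_class_smult[symmetric] cls)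
  have mult: "\<psi> (p * q) = \<psi> p \<otimes>\<^bsub>E\<^esub> \<psi> q" for p q
    unfolding \<psi>_def by (simp add: trunc_class_mult[symmetric] cls \<phi>.hom_mult)
  have zero: "\<psi> 0 = \<zero>\<^bsub>E\<^esub>"
    unfolding \<psi>_def by (simp add: trunc_class_zero)
  have kernel: "monom 1 n dvd p" if "\<psi> p = \<zero>\<^bsub>E\<^esub>" for p
  proof -
    have "\<phi> (trunc_class n p) = \<phi> (trunc_class n 0)"
      using that zero by (simp add: \<psi>_def)
    then have "trunc_class n p = trunc_class n 0"
      by (rule inj_onD[OF \<phi>.inj]) (rule cls)+
    then show ?thesis by (simp add: trunc_class_eq_iff)
  qed
  have "\<exists>u. u \<in> B \<rightarrow> carrier ?F \<and> \<phi>.E.lincomb u B = \<psi> p" for p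
    using \<phi>.E.finite_in_span[OF fin B] gen closed by blast
  then obtain co where co: "\<And>p. \<phi>.E.lincomb (co p) B = \<psi> p"
    by metis
  \<comment> \<open>Coordinates are chosen by \<open>co\<close> separately for each polynomial,
    hence not necessarily linearly. Only those of the powers of t are kept, as the columns of
    \<open>M\<close>, and are extended linearly in \<open>expand\<close>.\<close>
  define M where "M b j = co (monom 1 j) b" for b j
  define P where "P m c = (\<Sum>j<m. monom (c j) j)" for m and c :: "nat \<Rightarrow> 'a"
  have expand: "\<psi> (P m c) = \<phi>.E.lincomb (\<lambda>b. \<Sum>j<m. c j * M b j) B" for m c
  proof (induction m)
    case 0
    show ?case using B by (simp add: P_def zero \<phi>.E.lincomb_zero)
  next
    case (Suc m)
    have "\<psi> (P (Suc m) c) = \<psi> (P m c) \<oplus>\<^bsub>E\<^esub> c m \<odot>\<^bsub>E\<^esub> \<psi> (monom 1 m)"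
      by (simp add: P_def add scale[symmetric] smult_monom)
    also have "c m \<odot>\<^bsub>E\<^esub> \<psi> (monom 1 m) = \<phi>.E.lincomb (\<lambda>b. c m * M b m) B"
      using \<phi>.E.lincomb_smult[OF B, of "co (monom 1 m)" "c m"] by (simp add: co M_def)
    finally show ?case
      using \<phi>.E.lincomb_sum[OF fin B, of "\<lambda>b. \<Sum>j<m. c j * M b j" "\<lambda>b. c m * M b m"]
      by (simp add: Suc.IH)
  qed
  have coeff_P: "coeff (P m c) j = (if j < m then c j else 0)" for m c j
    by (simp add: P_def coeff_sum)
  have coords_zero: "\<forall>j<n. c j = 0" if "monom 1 n dvd P n c" for c
    using that by (auto simp: monom_1_dvd_iff' coeff_P)
  have separate: "\<forall>j<n. c j = 0" if "\<forall>b\<in>B. (\<Sum>j<n. c j * M b j) = 0" for c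
  proof (intro coords_zero kernel)
    show "\<psi> (P n c) = \<zero>\<^bsub>E\<^esub>"
      unfolding expand using B that by (intro \<phi>.E.lincomb_zero) auto
  qed
  obtain k where k: "n = Suc k" using n by (cases n) auto
  \<comment> \<open>The sequence \<open>case_nat a c\<close> has the constant term \<open>a\<close>
    followed by the coefficients \<open>c\<close> of t, t^2, ....\<close>
  have shift: "(\<Sum>j<n. case_nat a c j * M b j) = a * M b 0 + (\<Sum>j<k. c j * M b (Suc j))"
    for a c b unfolding k sum.lessThan_Suc_shift by simp
  have "\<forall>j<k. c j = 0" if "\<forall>b\<in>B. (\<Sum>j<k. c j * M b (Suc j)) = 0" for c
    using separate[of "case_nat 0 c"] that unfolding shift by (auto simp: k)
  \<comment> \<open>The constant term is fixed to be 1, which leaves \<open>k = n - 1\<close>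
    unknowns. The right-hand side \<open>- M b 0\<close> cancels the contribution of 1, so the
    coordinates of \<open>x\<close> below vanish on \<open>B1\<close>.\<close>
  from solvable_subsystem_of_injective[where M = "\<lambda>b j. M b (Suc j)" and r = "\<lambda>b. - M b 0", OF this]
  obtain B1 c1 where B1: "B1 \<subseteq> B" "card B1 = k"
    and c1: "\<forall>b\<in>B1. (\<Sum>j<k. c1 j * M b (Suc j)) = - M b 0"
    by blast
  define x where "x = P n (case_nat 1 c1)"
  have unit: "coeff x 0 \<noteq> 0" using n by (simp add: x_def coeff_P)
  \<comment> \<open>Let the coordinates of y vanish outside \<open>B1\<close>. Those of
    \<open>x\<close> vanish on \<open>B1\<close>, so x y maps to zero, and cancelling the unit
    \<open>x\<close> gives y = 0 modulo t^n. Thus the rows of \<open>M\<close> outside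
    \<open>B1\<close> already form an injective matrix.\<close>
  have "\<forall>j<n. c j = 0" if c: "\<forall>b\<in>B - B1. (\<Sum>j<n. c j * M b j) = 0" for c
  proof (rule coords_zero, rule monom_dvd_mult_cancel[OF unit], rule kernel)
    show "\<psi> (x * P n c) = \<zero>\<^bsub>E\<^esub>"
      unfolding mult x_def expand
    proof (rule \<phi>.E.lincomb_mult_eq_zero[OF fin B orth])
      fix b assume "b \<in> B"
      then show "(\<Sum>j<n. case_nat 1 c1 j * M b j) = \<zero>\<^bsub>?F\<^esub> \<or> (\<Sum>j<n. c j * M b j) = \<zero>\<^bsub>?F\<^esub>"
        unfolding shift using c c1 by auto
    qed auto
  qed
  from solvable_subsystem_of_injective[where M = M, OF this]
  obtain B2 where B2: "B2 \<subseteq> B - B1" "card B2 = n" by blast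
  have "card B2 + card B1 = card (B2 \<union> B1)"
    using B1 B2 fin by (intro card_Un_disjoint[symmetric]) (auto intro: finite_subset)
  also have "\<dots> \<le> card B" using B1 B2 fin by (intro card_mono) auto
  finally show ?thesis using B1 B2 k by simp
qed

lemma dim_evolution_algebra_ge:
  fixes E :: "('a::field, 'e) module"
  assumes n: "n \<ge> 1" and evo: "evolution_algebra (class_ring :: 'a ring) E"
    and fd: "vectorspace.fin_dim (class_ring :: 'a ring) E"
    and mono: "algebra_mono (class_ring :: 'a ring)
      (trunc_poly_algebra n :: ('a, 'a poly set) module) E \<phi>"
  shows "2 * n - 1 \<le> vectorspace.dim (class_ring :: 'a ring) E"
proof -
  let ?F = "class_ring :: 'a ring"
  obtain B where B: "natural_basis ?F E B" and alg: "nonassoc_algebra ?F E"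
    using evo by (auto simp: evolution_algebra_def)
  interpret E: nonassoc_algebra ?F E by (rule alg)
  have bas: "E.basis B" using B by (simp add: natural_basis_def)
  then have fin: "finite B" using E.fin_dim_li_fin[OF fd] by (auto simp: E.basis_def)
  have "2 * n - 1 \<le> card B"
    using bas B by (intro card_orthogonal_generators_ge[OF n mono fin])
      (auto simp: E.basis_def natural_basis_def)
  then show ?thesis using E.dim_basis[OF fin bas] by simp
qed

section \<open>Upper bound: an evolution algebra from Lagrange interpolation\<close>

text \<open>The first reduction makes the product that of F^S, with evaluation at the points of
  \<open>S\<close> as coordinates. The second is linear, so orthogonal pairs stay orthogonal; it
  makes the polynomials of degree less than \<open>n\<close> multiply as in F[t]/(t^n).\<close>

definition interpolation_algebra :: "nat \<Rightarrow> 'a::field set \<Rightarrow> ('a, 'a poly) module" where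
  "interpolation_algebra n S =
     \<lparr>carrier = {p. degree p < card S},
      mult = (\<lambda>p q. p * q mod (\<Prod>a\<in>S. [:- a, 1:]) mod monom 1 n),
      one = 1, zero = 0, add = (+), smult = Polynomial.smult\<rparr>"

context
  fixes n :: nat and S :: "'a::field set"
  assumes n: "n \<ge> 1" and fin: "finite S" and card_S: "card S = 2 * n - 1"
begin

private abbreviation (input) "E \<equiv> interpolation_algebra n S"
private abbreviation (input) "F \<equiv> class_ring :: 'a ring"

text \<open>Up to a scalar, this is the Lagrange basis polynomial of the node
  \<open>a\<close>.\<close>

definition "nodal a = (\<Prod>c\<in>S - {a}. [:- c, 1:])"

lemma degree_mod_monom_less: "degree (p mod monom (1::'a) n) < n"
  using degree_mod_less[of "monom 1 n" p] n by (auto simp: degree_monom_eq)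

lemma degree_prod_linear_factors: "degree (\<Prod>a\<in>S. [:- a, 1:]) = card S"
  using fin by (subst degree_prod_eq_sum_degree) auto

lemma interpolation_nonassoc_algebra: "nonassoc_algebra F E"
proof -
  have "vectorspace F E"
  proof (rule vs_criteria[OF class_field])
    show "\<forall>v\<in>carrier E. \<exists>w\<in>carrier E. v \<oplus>\<^bsub>E\<^esub> w = \<zero>\<^bsub>E\<^esub>"
      by (intro ballI bexI[of _ "- v" for v]) (auto simp: interpolation_algebra_def)
  qed (use n card_S in \<open>auto simp: interpolation_algebra_def smult_add_left smult_add_right
        degree_add_less intro: le_less_trans[OF degree_smult_le]\<close>)
  \<comment> \<open>Products are remainders of degree less than \<open>n\<close>, and
    \<open>n \<le> 2 * n - 1\<close> because \<open>n \<ge> 1\<close>.\<close>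
  moreover have "degree (p mod monom 1 n) < card S" for p :: "'a poly"
    using degree_mod_monom_less[of p] n card_S by simp
  ultimately show ?thesis
    by (intro nonassoc_algebra.intro nonassoc_algebra_axioms.intro)
      (auto simp: interpolation_algebra_def distrib_left distrib_right poly_mod_add_left
        mod_smult_left)
qed

interpretation E: nonassoc_algebra F E
  by (rule interpolation_nonassoc_algebra)

lemma poly_nodal_eq_0_iff: "a \<in> S \<Longrightarrow> c \<in> S \<Longrightarrow> poly (nodal a) c = 0 \<longleftrightarrow> a \<noteq> c"
  using fin by (auto simp: nodal_def poly_prod)

lemma inj_on_nodal: "inj_on nodal S"
  by (rule inj_onI) (metis poly_nodal_eq_0_iff)

lemma nodal_closed: "nodal ` S \<subseteq> carrier E"
proof -
  have "degree (nodal a) = card (S - {a})" for a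
    unfolding nodal_def using fin by (subst degree_prod_eq_sum_degree) auto
  moreover have "card (S - {a}) < card S" if "a \<in> S" for a
    using fin that by (rule card_Diff1_less)
  ultimately show ?thesis by (auto simp: interpolation_algebra_def)
qed

lemma lincomb_nodal: "E.lincomb u (nodal ` S) = (\<Sum>a\<in>S. Polynomial.smult (u (nodal a)) (nodal a))"
proof -
  have sum: "finsum E f T = sum f T" if "finite T" "f \<in> T \<rightarrow> carrier E" for f and T :: "'a poly set"
    using that by (induction T) (auto simp: Pi_iff, simp_all add: interpolation_algebra_def)
  have "E.lincomb u (nodal ` S) = (\<Sum>v\<in>nodal ` S. u v \<odot>\<^bsub>E\<^esub> v)"
    unfolding E.lincomb_def using fin nodal_closed by (intro sum) auto
  also have "\<dots> = (\<Sum>v\<in>nodal ` S. Polynomial.smult (u v) v)"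
    by (simp add: interpolation_algebra_def)
  finally show ?thesis by (simp add: sum.reindex[OF inj_on_nodal])
qed

text \<open>At the node \<open>a\<close> every other nodal polynomial vanishes, so evaluation there
  isolates one coefficient.\<close>

lemma poly_lincomb_nodal:
  assumes "a \<in> S"
  shows "poly (E.lincomb u (nodal ` S)) a = u (nodal a) * poly (nodal a) a"
proof -
  have "poly (E.lincomb u (nodal ` S)) a = (\<Sum>c\<in>S. u (nodal c) * poly (nodal c) a)"
    by (simp add: lincomb_nodal poly_sum)
  also have "\<dots> = (\<Sum>c\<in>S. if c = a then u (nodal a) * poly (nodal a) a else 0)"
    using assms by (intro sum.cong refl) (auto simp: poly_nodal_eq_0_iff)
  finally show ?thesis using fin assms by simp
qed

lemma natural_basis_nodal: "natural_basis F E (nodal ` S)"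
  unfolding natural_basis_def E.basis_def
proof (intro conjI ballI impI nodal_closed)
  have finB: "finite (nodal ` S)" using fin by simp
  show "E.lin_indpt (nodal ` S)"
  proof (rule E.finite_lin_indpt2[OF finB nodal_closed])
    fix u assume "E.lincomb u (nodal ` S) = \<zero>\<^bsub>E\<^esub>"
    then have "E.lincomb u (nodal ` S) = 0" by (simp add: interpolation_algebra_def)
    then have "u (nodal a) * poly (nodal a) a = 0" if "a \<in> S" for a
      using poly_lincomb_nodal[OF that, of u] by simp
    then show "\<forall>v\<in>nodal ` S. u v = \<zero>\<^bsub>F\<^esub>" by (auto simp: poly_nodal_eq_0_iff)
  qed
  show "E.span (nodal ` S) = carrier E"
  proof
    show "E.span (nodal ` S) \<subseteq> carrier E" by (rule E.span_is_subset2[OF nodal_closed])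
    show "carrier E \<subseteq> E.span (nodal ` S)"
    proof
      fix p assume p: "p \<in> carrier E"
      \<comment> \<open>Lagrange coefficients: the value of \<open>p\<close> at a node, divided by
        the value of its nodal polynomial there. The node is recovered from the polynomial by
        injectivity of \<open>nodal\<close>.\<close>
      define u where "u v = (let a = inv_into S nodal v in poly p a / poly v a)" for v
      have u: "u (nodal a) = poly p a / poly (nodal a) a" if "a \<in> S" for a
        using that by (simp add: u_def inv_into_f_f[OF inj_on_nodal])
      have "E.lincomb u (nodal ` S) \<in> carrier E"
        by (intro E.lincomb_closed nodal_closed) auto
      then have "degree (E.lincomb u (nodal ` S)) < card S" "degree p < card S"
        using p by (simp_all add: interpolation_algebra_def)
      then have "E.lincomb u (nodal ` S) = p"
        by (intro poly_eqI_degree[of S]) (simp_all add: poly_lincomb_nodal u poly_nodal_eq_0_iff)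
      then show "p \<in> E.span (nodal ` S)"
        by (auto simp: E.finite_span[OF finB nodal_closed])
    qed
  qed
next
  fix v w assume "v \<in> nodal ` S" "w \<in> nodal ` S" "v \<noteq> w"
  then obtain a c where ac: "v = nodal a" "w = nodal c" "a \<in> S" "c \<in> S" "a \<noteq> c" by auto
  \<comment> \<open>The only linear factor missing from \<open>nodal a\<close> is t - a, and this
    one divides \<open>nodal c\<close>.\<close>
  have "nodal a * [:- a, 1:] = (\<Prod>a\<in>S. [:- a, 1:])"
    unfolding nodal_def using fin ac by (simp add: prod.remove[of S a] mult.commute)
  moreover have "[:- a, 1:] dvd nodal c"
    unfolding nodal_def using fin ac by (intro dvd_prodI) auto
  ultimately have "(\<Prod>a\<in>S. [:- a, 1:]) dvd nodal a * nodal c"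
    by (metis mult_dvd_mono dvd_refl)
  then show "v \<otimes>\<^bsub>E\<^esub> w = \<zero>\<^bsub>E\<^esub>" using ac by (simp add: interpolation_algebra_def dvd_imp_mod_0)
qed

lemma evolution_algebra_interpolation: "evolution_algebra F E"
  using interpolation_nonassoc_algebra natural_basis_nodal by (auto simp: evolution_algebra_def)

lemma fin_dim_interpolation: "E.fin_dim"
  using natural_basis_nodal nodal_closed fin
  by (auto simp: E.fin_dim_def natural_basis_def E.basis_def intro!: exI[of _ "nodal ` S"])

lemma dim_interpolation: "E.dim = 2 * n - 1"
  using E.dim_basis[of "nodal ` S"] natural_basis_nodal fin card_S
  by (simp add: natural_basis_def card_image[OF inj_on_nodal])

lemma algebra_mono_interpolation:
  "\<exists>\<phi>. algebra_mono F (trunc_poly_algebra n :: ('a, 'a poly set) module) E \<phi>"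
proof -
  let ?A = "trunc_poly_algebra n :: ('a, 'a poly set) module" and ?t = "monom 1 n :: 'a poly"
  \<comment> \<open>A class is sent to the remainder of any representative; the remainder depends
    only on the class.\<close>
  define \<phi> where "\<phi> X = inv_into UNIV (trunc_class n) X mod ?t" for X
  have \<phi>: "\<phi> (trunc_class n p) = p mod ?t" for p
  proof -
    have "trunc_class n (inv_into UNIV (trunc_class n) (trunc_class n p)) = trunc_class n p"
      by (rule f_inv_into_f) simp
    then show ?thesis by (simp add: \<phi>_def trunc_class_eq_iff mod_eq_dvd_iff)
  qed
  interpret A: nonassoc_algebra F ?A by (rule trunc_poly_algebra_is_nonassoc_algebra)
  have "linear_map F ?A E \<phi>"
  proof unfold_locales
    have "degree (p mod ?t) < card S" for p
      using degree_mod_monom_less[of p] n card_S by simp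
    then show "\<phi> \<in> LinearCombinations.module_hom F ?A E"
      by (auto simp: LinearCombinations.module_hom_def carrier_trunc_poly_algebra
          trunc_class_add trunc_class_smult \<phi> interpolation_algebra_def poly_mod_add_left
          mod_smult_left)
  qed
  moreover have "\<phi> (X \<otimes>\<^bsub>?A\<^esub> Y) = \<phi> X \<otimes>\<^bsub>E\<^esub> \<phi> Y" if "X \<in> carrier ?A" "Y \<in> carrier ?A" for X Y
  proof -
    obtain p q where pq: "X = trunc_class n p" "Y = trunc_class n q"
      using \<open>X \<in> carrier ?A\<close> \<open>Y \<in> carrier ?A\<close> by (auto simp: carrier_trunc_poly_algebra)
    \<comment> \<open>The product of two remainders has degree at most \<open>2 * n - 2\<close>,
      just below the degree \<open>2 * n - 1\<close> of the product of the linear factors, so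
      reducing modulo the latter leaves it unchanged.\<close>
    have "degree ((p mod ?t) * (q mod ?t)) < card S"
      using degree_mult_le[of "p mod ?t" "q mod ?t"] degree_mod_monom_less[of p]
        degree_mod_monom_less[of q] card_S by linarith
    then have "(p mod ?t) * (q mod ?t) mod (\<Prod>a\<in>S. [:- a, 1:]) = (p mod ?t) * (q mod ?t)"
      by (intro mod_poly_less) (simp add: degree_prod_linear_factors)
    then show ?thesis
      by (simp add: pq trunc_class_mult \<phi> interpolation_algebra_def mod_mult_eq)
  qed
  moreover have "inj_on \<phi> (carrier ?A)"
    by (rule inj_onI)
      (clarsimp simp: carrier_trunc_poly_algebra \<phi>, simp add: trunc_class_eq_iff mod_eq_dvd_iff)
  ultimately show ?thesis
    by (intro exI[of _ \<phi>] algebra_mono.intro algebra_mono_axioms.intro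
        A.nonassoc_algebra_axioms interpolation_nonassoc_algebra)
qed

end

section \<open>The minimal evolution dimension of F[t]/(t^n)\<close>

theorem theorem5p6:
  fixes n :: nat
  assumes "n \<ge> 1"
    and "CHAR('a::field) \<noteq> 2"
    and "\<exists>S :: 'a set. finite S \<and> card S = 2 * n - 1"
  shows "edim (class_ring :: 'a ring) (trunc_poly_algebra n :: ('a, 'a poly set) module) = 2 * n - 1
    \<and> (n > 1 \<longrightarrow>
         \<not> evolution_algebra (class_ring :: 'a ring)
             (trunc_poly_algebra n :: ('a, 'a poly set) module))"
proof (intro conjI impI notI)
  let ?F = "class_ring :: 'a ring"
  let ?A = "trunc_poly_algebra n :: ('a, 'a poly set) module"
  obtain S :: "'a set" where S: "finite S" "card S = 2 * n - 1" using assms(3) by blast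
  let ?E = "interpolation_algebra n S"
  note E = evolution_algebra_interpolation[OF assms(1) S] fin_dim_interpolation[OF assms(1) S]
  obtain \<phi> where \<phi>: "algebra_mono ?F ?A ?E \<phi>"
    using algebra_mono_interpolation[OF assms(1) S] by blast
  have dim: "vectorspace.dim ?F ?E = 2 * n - 1"
    by (rule dim_interpolation[OF assms(1) S])
  show "edim ?F ?A = 2 * n - 1"
  proof (rule antisym)
    show "edim ?F ?A \<le> 2 * n - 1" using edim_le[OF E \<phi>] dim by simp
    \<comment> \<open>A lower bound passes to \<open>Inf\<close> only for a nonempty set. A copy of
      the interpolation algebra on vectors is a member of the one defining
      \<open>edim\<close>.\<close>
    obtain E' :: "('a, 'a vec) module" and \<psi> where
      E': "evolution_algebra ?F E'" "vectorspace.fin_dim ?F E'" "algebra_mono ?F ?E E' \<psi>"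
      using evolution_algebra_transport[OF E] by metis
    show "2 * n - 1 \<le> edim ?F ?A"
      unfolding edim_def
    proof (rule cInf_greatest)
      show "{vectorspace.dim ?F E | E :: ('a, 'a vec) module. evolution_algebra ?F E \<and>
          vectorspace.fin_dim ?F E \<and> (\<exists>\<phi>. algebra_mono ?F ?A E \<phi>)} \<noteq> {}"
        using E'(1,2) algebra_mono_compose[OF \<phi> E'(3)] by blast
    qed (use dim_evolution_algebra_ge[OF assms(1)] in blast)
  qed
  assume "n > 1" and evo: "evolution_algebra ?F ?A"
  \<comment> \<open>The lower bound applied to the identity embedding; as the dimension is at most
    \<open>n\<close>, it forces \<open>n \<le> 1\<close>.\<close>
  have "2 * n - 1 \<le> vectorspace.dim ?F ?A"
    by (rule dim_evolution_algebra_ge[OF assms(1) evo trunc_poly_algebra_dim_le(1)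
          algebra_mono_id[OF trunc_poly_algebra_is_nonassoc_algebra]])
  then show False using trunc_poly_algebra_dim_le(2)[where 'a = 'a, of n] \<open>n > 1\<close> by linarith
qed

end
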